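(* Let $a,b,c,c_1,c_2\in\mathbb{R}$ with $ac_1+bc_2\neq0$ and $a^2\neq b^2$, and let $H(s)$ be a continuous function on an interval in $(0,\infty)$ containing $s_0$. There exists a 2-parameter family of pseudo-isotropic parabolic revolution surfaces of i-type in $\mathbb{I}^3_{\mathrm{p}}$ with $H$ as the mean curvature (i.e. the mean curvature at the point with parameters $(s,t)$ is $H(s)$) and whose generating curves $\alpha_{h_0,h_1}(s)$, where $s>0$ is an arc-length parameter, satisfy $$z(s)=h_0+h_1s+\frac{ac_1-bc_2}{2(a^2-b^2)}\,s^2-\frac{2B^2}{a^2-b^2}\int_{s_0}^{s}\int_{s_0}^{v}H(w)\,dw\,dv,$$ where $h_0,h_1$ are constants depending on the values of $z,z'$ at $s=s_0$; here $B=b$ if $\alpha_{h_0,h_1}(s)=(s,0,z(s))$ (in which case $b\neq0$ is assumed), and $B=a$ if $\alpha_{h_0,h_1}(s)=(0,s,z(s))$ (in which case $a\neq0$ is assumed).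
   Context: The pseudo-isotropic space $\mathbb{I}^3_{\mathrm{p}}$ is $\mathbb{R}^3$ with the degenerate metric $\langle u,v\rangle_{pz}=u^1v^1-u^2v^2$. For a $C^2$ parameterized surface $\mathbf{x}(u^1,u^2)=(x^1,x^2,x^3)$ write $\mathbf{x}_i=\partial\mathbf{x}/\partial u^i$, $\mathbf{x}_{ij}=\partial^2\mathbf{x}/\partial u^i\partial u^j$, $x^i_k=\partial x^i/\partial u^k$, $X_{ij}=x^i_1x^j_2-x^j_1x^i_2$. The surface is admissible if $X_{12}\neq0$ (equivalently, the induced metric has rank 2). Put $g_{ij}=\langle\mathbf{x}_i,\mathbf{x}_j\rangle_{pz}$, $N_h=\left(\frac{X_{23}}{X_{12}},\frac{X_{13}}{X_{12}},1\right)$, $h_{ij}=\langle N_h,\mathbf{x}_{ij}\rangle_1$, where $\langle u,v\rangle_1=u^1v^1-u^2v^2+u^3v^3$. The Gaussian and mean curvatures are $$K=\frac{h_{11}h_{22}-h_{12}^2}{g_{11}g_{22}-g_{12}^2},\qquad H=\frac12\,\frac{g_{11}h_{22}-2g_{12}h_{12}+g_{22}h_{11}}{g_{11}g_{22}-g_{12}^2};$$ equivalently $K=\det L$, $H=\frac12\mathrm{tr}\,L$ with $L=-D\xi^{\mathrm p}$, $\xi^{\mathrm p}=\left(\alpha_1,\alpha_2,\frac12(1-\alpha_1^2+\alpha_2^2)\right)$, $\alpha_1=X_{23}/X_{12}$, $\alpha_2=X_{13}/X_{12}$. The parabolic revolution surfaces of i-type with parameters $a,b,c,c_1,c_2$,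 where $ac_1+bc_2\neq0$, are, with coordinates $(u^1,u^2)=(u,t)$ and $C^2$ generating curve $\alpha$: for $\alpha(u)=(x(u),0,z(u))$ (spacelike), $$Zh_3(u,t)=\left(at+x(u),\ bt,\ ct+\tfrac{ac_1+bc_2}{2}t^2+c_1t\,x(u)+z(u)\right),$$ and for $\alpha(u)=(0,y(u),z(u))$ (timelike), $$Wh_3(u,t)=\left(at,\ bt+y(u),\ ct+\tfrac{ac_1+bc_2}{2}t^2+c_2t\,y(u)+z(u)\right).$$ They are admissible when $bx'\neq0$, respectively $ay'\neq0$; surfaces are assumed admissible. *)

theory Defs
  imports "HOL-Analysis.Analysis"
begin

text \<open>
  Parametrised objects live on an interval \<open>I\<close> (curves) or on a product \<open>I \<times> J\<close> of intervals
  (surfaces).  Intervals need not be open: every derivative is taken within the interval, which is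
  the ordinary derivative at interior points and the one-sided one at end points.
\<close>

definition pz_inner :: "real^3 \<Rightarrow> real^3 \<Rightarrow> real" where
  "pz_inner u v = u$1 * v$1 - u$2 * v$2"

definition inner_1 :: "real^3 \<Rightarrow> real^3 \<Rightarrow> real" where
  "inner_1 u v = u$1 * v$1 - u$2 * v$2 + u$3 * v$3"

definition C2_curve_on :: "real set \<Rightarrow> (real \<Rightarrow> real^3) \<Rightarrow> bool" where
  "C2_curve_on I \<alpha> \<longleftrightarrow>
     (let \<alpha>' = (\<lambda>s. vector_derivative \<alpha> (at s within I));
          \<alpha>'' = (\<lambda>s. vector_derivative \<alpha>' (at s within I))
      in (\<forall>s\<in>I. \<alpha> differentiable (at s within I) \<and> \<alpha>' differentiable (at s within I))
         \<and> continuous_on I \<alpha>'')"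

definition arc_length_param_on :: "real set \<Rightarrow> (real \<Rightarrow> real^3) \<Rightarrow> bool" where
  "arc_length_param_on I \<alpha> \<longleftrightarrow>
     (\<forall>s\<in>I. let T = vector_derivative \<alpha> (at s within I) in \<bar>pz_inner T T\<bar> = 1)"

definition partial_1 :: "real set \<Rightarrow> (real \<Rightarrow> real \<Rightarrow> real^3) \<Rightarrow> real \<Rightarrow> real \<Rightarrow> real^3" where
  "partial_1 I f u v = vector_derivative (\<lambda>r. f r v) (at u within I)"

definition partial_2 :: "real set \<Rightarrow> (real \<Rightarrow> real \<Rightarrow> real^3) \<Rightarrow> real \<Rightarrow> real \<Rightarrow> real^3" where
  "partial_2 J f u v = vector_derivative (\<lambda>r. f u r) (at v within J)"

definition C1_surface_on ::
    "real set \<Rightarrow> real set \<Rightarrow> (real \<Rightarrow> real \<Rightarrow> real^3) \<Rightarrow> bool" where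
  "C1_surface_on I J f \<longleftrightarrow>
     (\<forall>u\<in>I. \<forall>v\<in>J. (\<lambda>r. f r v) differentiable (at u within I)
                \<and> (\<lambda>r. f u r) differentiable (at v within J))
     \<and> continuous_on (I \<times> J) (\<lambda>(u, v). partial_1 I f u v)
     \<and> continuous_on (I \<times> J) (\<lambda>(u, v). partial_2 J f u v)"

definition C2_surface_on ::
    "real set \<Rightarrow> real set \<Rightarrow> (real \<Rightarrow> real \<Rightarrow> real^3) \<Rightarrow> bool" where
  "C2_surface_on I J f \<longleftrightarrow>
     C1_surface_on I J f \<and> C1_surface_on I J (partial_1 I f) \<and> C1_surface_on I J (partial_2 J f)"

definition X_minor ::
    "real set \<Rightarrow> real set \<Rightarrow> (real \<Rightarrow> real \<Rightarrow> real^3) \<Rightarrow> 3 \<Rightarrow> 3 \<Rightarrow> real \<Rightarrow> real \<Rightarrow> real" where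
  "X_minor I J f i j u v =
     partial_1 I f u v $ i * partial_2 J f u v $ j - partial_1 I f u v $ j * partial_2 J f u v $ i"

definition admissible_on ::
    "real set \<Rightarrow> real set \<Rightarrow> (real \<Rightarrow> real \<Rightarrow> real^3) \<Rightarrow> bool" where
  "admissible_on I J f \<longleftrightarrow> (\<forall>u\<in>I. \<forall>v\<in>J. X_minor I J f 1 2 u v \<noteq> 0)"

definition N_h ::
    "real set \<Rightarrow> real set \<Rightarrow> (real \<Rightarrow> real \<Rightarrow> real^3) \<Rightarrow> real \<Rightarrow> real \<Rightarrow> real^3" where
  "N_h I J f u v =
     vector [X_minor I J f 2 3 u v / X_minor I J f 1 2 u v,
             X_minor I J f 1 3 u v / X_minor I J f 1 2 u v,
             1]"

definition mean_curvature ::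
    "real set \<Rightarrow> real set \<Rightarrow> (real \<Rightarrow> real \<Rightarrow> real^3) \<Rightarrow> real \<Rightarrow> real \<Rightarrow> real" where
  "mean_curvature I J f u v =
     (let x1 = partial_1 I f u v;
          x2 = partial_2 J f u v;
          x11 = partial_1 I (partial_1 I f) u v;
          x12 = partial_2 J (partial_1 I f) u v;
          x22 = partial_2 J (partial_2 J f) u v;
          g11 = pz_inner x1 x1; g12 = pz_inner x1 x2; g22 = pz_inner x2 x2;
          h11 = inner_1 (N_h I J f u v) x11;
          h12 = inner_1 (N_h I J f u v) x12;
          h22 = inner_1 (N_h I J f u v) x22
      in (1/2) * ((g11 * h22 - 2 * g12 * h12 + g22 * h11) / (g11 * g22 - g12\<^sup>2)))"

definition spacelike_generating_curve :: "real set \<Rightarrow> (real \<Rightarrow> real^3) \<Rightarrow> bool" where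
  "spacelike_generating_curve I \<alpha> \<longleftrightarrow>
     C2_curve_on I \<alpha> \<and>
     (\<forall>s\<in>I. \<alpha> s $ 2 = 0 \<and>
        (let T = vector_derivative \<alpha> (at s within I) in pz_inner T T > 0))"

definition timelike_generating_curve :: "real set \<Rightarrow> (real \<Rightarrow> real^3) \<Rightarrow> bool" where
  "timelike_generating_curve I \<alpha> \<longleftrightarrow>
     C2_curve_on I \<alpha> \<and>
     (\<forall>s\<in>I. \<alpha> s $ 1 = 0 \<and>
        (let T = vector_derivative \<alpha> (at s within I) in pz_inner T T < 0))"

text \<open>
  In \<open>Zh3\<close> the generating curve is \<open>\<alpha> = (x, 0, z)\<close>; in \<open>Wh3\<close> it is \<open>\<alpha> = (0, y, z)\<close>.
\<close>

definition Zh3 ::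
    "real \<Rightarrow> real \<Rightarrow> real \<Rightarrow> real \<Rightarrow> real \<Rightarrow> (real \<Rightarrow> real^3) \<Rightarrow> real \<Rightarrow> real \<Rightarrow> real^3" where
  "Zh3 a b c c1 c2 \<alpha> u t =
     vector [a * t + \<alpha> u $ 1,
             b * t,
             c * t + (a * c1 + b * c2) / 2 * t\<^sup>2 + c1 * t * \<alpha> u $ 1 + \<alpha> u $ 3]"

definition Wh3 ::
    "real \<Rightarrow> real \<Rightarrow> real \<Rightarrow> real \<Rightarrow> real \<Rightarrow> (real \<Rightarrow> real^3) \<Rightarrow> real \<Rightarrow> real \<Rightarrow> real^3" where
  "Wh3 a b c c1 c2 \<alpha> u t =
     vector [a * t,
             b * t + \<alpha> u $ 2,
             c * t + (a * c1 + b * c2) / 2 * t\<^sup>2 + c2 * t * \<alpha> u $ 2 + \<alpha> u $ 3]"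

text \<open>
  The interval integrals are oriented, so points \<open>s < s\<^sub>0\<close> are covered.
\<close>

definition z_profile ::
    "real \<Rightarrow> real \<Rightarrow> real \<Rightarrow> real \<Rightarrow> real \<Rightarrow> (real \<Rightarrow> real) \<Rightarrow> real \<Rightarrow> real \<Rightarrow> real \<Rightarrow> real \<Rightarrow> real" where
  "z_profile a b c1 c2 B H s0 h0 h1 s =
     h0 + h1 * s + (a * c1 - b * c2) / (2 * (a\<^sup>2 - b\<^sup>2)) * s\<^sup>2
     - 2 * B\<^sup>2 / (a\<^sup>2 - b\<^sup>2)
         * (LBINT v=ereal s0..ereal s. (LBINT w=ereal s0..ereal v. H w))"

end

theory Submission
  imports Defs
begin

text \<open>
  Both surfaces have a linear top view: apart from the height coordinate, the point with
  parameters \<open>(u, t)\<close> is \<open>t (a, b) + u (p, q)\<close>, with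
  \<open>(p, q) = (1, 0)\<close> for the i-type surface of a spacelike curve and \<open>(p, q) = (0, 1)\<close> for that of a
  timelike one.  The degenerate metric sees only the top view, so the first fundamental form is
  constant, with determinant \<open>- (p b - q a)\<^sup>2\<close>.  All second partial derivatives are vertical, and
  the normal \<open>N\<^sub>h\<close> has height component \<open>1\<close>, so the \<open>h\<^sub>i\<^sub>j\<close> are just the second partial derivatives
  of the height \<open>c t + k t\<^sup>2 / 2 + m t u + z u\<close>, namely \<open>z''\<close>, \<open>m\<close> and \<open>k\<close>.  Hence the mean
  curvature depends on \<open>u\<close> alone and is an affine function of \<open>z'' u\<close>
  (\<open>mean_curvature_parabolic\<close>), with slope \<open>- (a\<^sup>2 - b\<^sup>2) / (2 (p b - q a)\<^sup>2) \<noteq> 0\<close>.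

  Prescribing it therefore means prescribing \<open>z''\<close>.  Solving the affine equation for \<open>z''\<close> and
  integrating twice from \<open>s\<^sub>0\<close> gives the profile in question; that the profile does have this second
  derivative is the fundamental theorem of calculus on an interval that may be open, closed or
  half-open (\<open>interval_integral_has_vector_derivative\<close>).  The double integral vanishes at
  \<open>s\<^sub>0\<close> together with its first derivative, so the constants \<open>(h\<^sub>0, h\<^sub>1)\<close> and the initial values of
  \<open>(z, z')\<close> determine each other by a triangular affine map, which is where the two parameters of
  the family come from.
\<close>

section \<open>Calculus on intervals with arbitrary end points\<close>

lemma interval_at_within_nontrivial:
  fixes I :: "real set"
  assumes "is_interval I" "interior I \<noteq> {}" "x \<in> I"
  shows "at x within I \<noteq> bot"
proof -
  obtain y where "y \<in> interior I" using assms(2) by blast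
  then have "I \<noteq> {z}" for z
    by (metis empty_iff interior_singleton)
  moreover have "connected I"
    using assms(1) is_interval_connected by blast
  ultimately have "x islimpt I"
    using assms(3) by (intro connected_imp_perfect)
  then show ?thesis
    by (simp add: trivial_limit_within)
qed

text \<open>
  This reduces to the fundamental theorem of calculus on compact intervals: near \<open>x\<close> the interval
  \<open>I\<close> agrees with a compact interval contained in \<open>I\<close> that also contains the base point, and both
  the derivative at \<open>x\<close> and the integrals up to points near \<open>x\<close> only see that compact interval.
\<close>

lemma interval_integral_has_vector_derivative:
  fixes f :: "real \<Rightarrow> real" and I :: "real set"
  assumes I: "is_interval I" and "s0 \<in> I" "x \<in> I" and f: "continuous_on I f"
  shows "((\<lambda>s. LBINT v=ereal s0..ereal s. f v) has_vector_derivative f x) (at x within I)"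
proof -
  \<comment> \<open>A point of \<open>I\<close> beyond \<open>x\<close> on either side, if there is one; otherwise \<open>x\<close> is an end point.\<close>
  obtain l where l: "l \<in> I" "l \<le> x" "l < x \<or> (\<forall>y\<in>I. x \<le> y)"
  proof (cases "\<exists>y\<in>I. y < x")
    case True
    then show ?thesis using that less_imp_le by blast
  next
    case False
    then show ?thesis using that[of x] \<open>x \<in> I\<close> by (simp add: not_less)
  qed
  obtain r where r: "r \<in> I" "x \<le> r" "x < r \<or> (\<forall>y\<in>I. y \<le> x)"
  proof (cases "\<exists>y\<in>I. x < y")
    case True
    then show ?thesis using that less_imp_le by blast
  next
    case False
    then show ?thesis using that[of x] \<open>x \<in> I\<close> by (simp add: not_less)
  qed
  define a where "a = min l s0"
  define b where "b = max r s0"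
  have ab: "a \<in> I" "b \<in> I" "a \<le> s0" "s0 \<le> b" "a \<le> x" "x \<le> b"
    using l r \<open>s0 \<in> I\<close> by (auto simp: a_def b_def min_def max_def)
  have sub: "{a..b} \<subseteq> I"
    using mem_is_interval_1_I[OF I ab(1,2)] by auto
  define S where "S = {(if l < x then l else x - 1) <..< (if x < r then r else x + 1)}"
  have "at x within {a..b} = at x within I"
  proof (rule at_within_nhd[of x S])
    show "x \<in> S" "open S" by (auto simp: S_def)
    have "y \<in> {a..b}" if y: "y \<in> I" "y \<in> S" for y
    proof -
      have "l \<le> y"
      proof (cases "l < x")
        case True
        then show ?thesis using y(2) by (simp add: S_def)
      next
        case False
        then show ?thesis using y(1) l by fastforce
      qed
      moreover have "y \<le> r"
      proof (cases "x < r")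
        case True
        then show ?thesis using y(2) by (simp add: S_def)
      next
        case False
        then show ?thesis using y(1) r by fastforce
      qed
      ultimately show ?thesis by (auto simp: a_def b_def)
    qed
    then show "{a..b} \<inter> S - {x} = I \<inter> S - {x}"
      using sub by blast
  qed
  moreover have "((\<lambda>s. LBINT v=ereal s0..ereal s. f v) has_vector_derivative f x)
      (at x within {a..b})"
    using ab continuous_on_subset[OF f sub] by (intro interval_integral_FTC2) simp_all
  ultimately show ?thesis by simp
qed

lemma vector_3_eq_axis:
  "vector [x, y, z] = x *\<^sub>R axis 1 1 + y *\<^sub>R axis 2 1 + z *\<^sub>R (axis 3 1 :: real^3)"
  by (simp add: vec_eq_iff forall_3 axis_def)

lemma has_vector_derivative_vector_3:
  assumes "(f has_vector_derivative f') F" "(g has_vector_derivative g') F"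
    "(h has_vector_derivative h') F"
  shows "((\<lambda>r. vector [f r, g r, h r] :: real^3) has_vector_derivative vector [f', g', h']) F"
  unfolding vector_3_eq_axis using assms
  by (intro has_vector_derivative_add
      bounded_linear.has_vector_derivative[OF bounded_linear_scaleR_left])

lemma continuous_on_vector_3:
  fixes f g h :: "'a::topological_space \<Rightarrow> real"
  assumes "continuous_on S f" "continuous_on S g" "continuous_on S h"
  shows "continuous_on S (\<lambda>r. vector [f r, g r, h r] :: real^3)"
  unfolding vector_3_eq_axis
  by (intro continuous_on_add continuous_on_scaleR continuous_on_const assms)

section \<open>Recognising partial derivatives\<close>

definition has_partials_on ::
    "real set \<Rightarrow> real set \<Rightarrow> (real \<Rightarrow> real \<Rightarrow> real^3) \<Rightarrow>
     (real \<Rightarrow> real \<Rightarrow> real^3) \<Rightarrow> (real \<Rightarrow> real \<Rightarrow> real^3) \<Rightarrow> bool" where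
  "has_partials_on I J f f1 f2 \<longleftrightarrow>
     (\<forall>u\<in>I. \<forall>v\<in>J. ((\<lambda>r. f r v) has_vector_derivative f1 u v) (at u within I) \<and>
                  ((\<lambda>r. f u r) has_vector_derivative f2 u v) (at v within J))"

text \<open>
  The partial derivatives of a surface are known only at parameters in \<open>I \<times> J\<close>; this is how
  they can still be differentiated a second time.
\<close>

lemma has_partials_on_cong:
  assumes "has_partials_on I J f f1 f2" "\<And>u v. u \<in> I \<Longrightarrow> v \<in> J \<Longrightarrow> g u v = f u v"
  shows "has_partials_on I J g f1 f2"
  unfolding has_partials_on_def
proof (intro ballI conjI)
  fix u v assume uv: "u \<in> I" "v \<in> J"
  then have f: "((\<lambda>r. f r v) has_vector_derivative f1 u v) (at u within I)"
      "((\<lambda>r. f u r) has_vector_derivative f2 u v) (at v within J)"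
    using assms(1) unfolding has_partials_on_def by blast+
  show "((\<lambda>r. g r v) has_vector_derivative f1 u v) (at u within I)"
    by (rule has_vector_derivative_transform[OF uv(1) _ f(1)]) (rule assms(2)[OF _ uv(2)])
  show "((\<lambda>r. g u r) has_vector_derivative f2 u v) (at v within J)"
    by (rule has_vector_derivative_transform[OF uv(2) _ f(2)]) (rule assms(2)[OF uv(1)])
qed

lemma has_partials_on_imp_partial_1:
  assumes "has_partials_on I J f f1 f2" "u \<in> I" "v \<in> J" "at u within I \<noteq> bot"
  shows "partial_1 I f u v = f1 u v"
  unfolding partial_1_def using assms
  by (intro vector_derivative_within) (simp_all add: has_partials_on_def)

lemma has_partials_on_imp_partial_2:
  assumes "has_partials_on I J f f1 f2" "u \<in> I" "v \<in> J" "at v within J \<noteq> bot"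
  shows "partial_2 J f u v = f2 u v"
  unfolding partial_2_def using assms
  by (intro vector_derivative_within) (simp_all add: has_partials_on_def)

lemma C1_surface_onI:
  assumes f: "has_partials_on I J f f1 f2"
    and cont: "continuous_on (I \<times> J) (\<lambda>(u, v). f1 u v)"
      "continuous_on (I \<times> J) (\<lambda>(u, v). f2 u v)"
    and nontriv: "\<And>u. u \<in> I \<Longrightarrow> at u within I \<noteq> bot" "\<And>v. v \<in> J \<Longrightarrow> at v within J \<noteq> bot"
  shows "C1_surface_on I J f"
proof -
  have "continuous_on (I \<times> J) (\<lambda>(u, v). partial_1 I f u v)"
    using cont(1) by (rule continuous_on_eq)
      (auto simp: has_partials_on_imp_partial_1[OF f] nontriv)
  moreover have "continuous_on (I \<times> J) (\<lambda>(u, v). partial_2 J f u v)"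
    using cont(2) by (rule continuous_on_eq)
      (auto simp: has_partials_on_imp_partial_2[OF f] nontriv)
  ultimately show ?thesis
    using f differentiableI_vector unfolding C1_surface_on_def has_partials_on_def by blast
qed

section \<open>Surfaces with linear top view and a profile added to a quadratic height\<close>

text \<open>
  The common form of \<open>Zh3\<close> and \<open>Wh3\<close> for a generating curve with profile \<open>z\<close> whose top view is
  the line through the origin in direction \<open>(p, q)\<close>; there \<open>k = a c1 + b c2\<close>, and \<open>m\<close> is \<open>c1\<close> or
  \<open>c2\<close>.
\<close>

definition parabolic_surface ::
    "real \<Rightarrow> real \<Rightarrow> real \<Rightarrow> real \<Rightarrow> real \<Rightarrow> real \<Rightarrow> real \<Rightarrow> (real \<Rightarrow> real) \<Rightarrow>
     real \<Rightarrow> real \<Rightarrow> real^3" where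
  "parabolic_surface a b p q c k m z u t =
     vector [a * t + p * u, b * t + q * u, c * t + k / 2 * t\<^sup>2 + m * t * u + z u]"

locale twice_differentiable_profile =
  fixes I :: "real set" and z z' z'' :: "real \<Rightarrow> real"
  assumes interval: "is_interval I" "interior I \<noteq> {}"
    and z: "\<And>s. s \<in> I \<Longrightarrow> (z has_vector_derivative z' s) (at s within I)"
    and z': "\<And>s. s \<in> I \<Longrightarrow> (z' has_vector_derivative z'' s) (at s within I)"
    and z'': "continuous_on I z''"
begin

lemma nontrivial: "s \<in> I \<Longrightarrow> at s within I \<noteq> bot"
  using interval by (rule interval_at_within_nontrivial)

lemma continuous_on_z': "continuous_on I z'"
  using z' by (rule continuous_on_vector_derivative)

lemma line_profile_derivatives:
  fixes p q :: real
  assumes "s \<in> I"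
  defines "\<alpha> \<equiv> \<lambda>s. vector [p * s, q * s, z s] :: real^3"
  shows "(\<alpha> has_vector_derivative vector [p, q, z' s]) (at s within I)"
    and "vector_derivative \<alpha> (at s within I) = vector [p, q, z' s]"
    and "((\<lambda>s. vector_derivative \<alpha> (at s within I)) has_vector_derivative vector [0, 0, z'' s])
          (at s within I)"
proof -
  have d: "(\<alpha> has_vector_derivative vector [p, q, z' s]) (at s within I)" if "s \<in> I" for s
    unfolding \<alpha>_def by (intro has_vector_derivative_vector_3 z that)
      (auto intro!: derivative_eq_intros simp flip: has_real_derivative_iff_has_vector_derivative)
  have e: "vector_derivative \<alpha> (at s within I) = vector [p, q, z' s]" if "s \<in> I" for s
    by (rule vector_derivative_within[OF nontrivial[OF that] d[OF that]])
  show "(\<alpha> has_vector_derivative vector [p, q, z' s]) (at s within I)"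
    and "vector_derivative \<alpha> (at s within I) = vector [p, q, z' s]"
    using d e assms(1) by blast+
  have "((\<lambda>s. vector [p, q, z' s] :: real^3) has_vector_derivative vector [0, 0, z'' s])
      (at s within I)"
    by (intro has_vector_derivative_vector_3 has_vector_derivative_const z' assms(1))
  then show "((\<lambda>s. vector_derivative \<alpha> (at s within I)) has_vector_derivative vector [0, 0, z'' s])
      (at s within I)"
    by (rule has_vector_derivative_transform[OF assms(1), rotated]) (simp add: e)
qed

lemma C2_curve_line_profile:
  "C2_curve_on I (\<lambda>s. vector [p * s, q * s, z s])"
proof -
  let ?\<alpha> = "\<lambda>s. vector [p * s, q * s, z s] :: real^3"
  let ?\<alpha>' = "\<lambda>s. vector_derivative ?\<alpha> (at s within I)"
  have "continuous_on I (\<lambda>s. vector [0, 0, z'' s] :: real^3)"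
    by (intro continuous_on_vector_3 z'' continuous_on_const)
  moreover have "vector_derivative ?\<alpha>' (at s within I) = vector [0, 0, z'' s]" if "s \<in> I" for s
    by (rule vector_derivative_within[OF nontrivial[OF that] line_profile_derivatives(3)[OF that]])
  ultimately have "continuous_on I (\<lambda>s. vector_derivative ?\<alpha>' (at s within I))"
    by (simp cong: continuous_on_cong)
  then show ?thesis
    unfolding C2_curve_on_def Let_def
    by (intro conjI ballI differentiableI_vector[OF line_profile_derivatives(1)]
        differentiableI_vector[OF line_profile_derivatives(3)])
qed

context
  fixes a b p q c k m :: real
begin

abbreviation (input) "X \<equiv> parabolic_surface a b p q c k m z"

lemma partials_X:
  "has_partials_on I UNIV X
     (\<lambda>u t. vector [p, q, m * t + z' u]) (\<lambda>u t. vector [a, b, c + k * t + m * u])"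
  unfolding has_partials_on_def parabolic_surface_def
proof (intro ballI conjI)
  fix u t :: real assume u: "u \<in> I"
  have z_u: "(z has_real_derivative z' u) (at u within I)"
    using z[OF u] by (simp add: has_real_derivative_iff_has_vector_derivative)
  show "((\<lambda>r. vector [a * t + p * r, b * t + q * r, c * t + k / 2 * t\<^sup>2 + m * t * r + z r] :: real^3)
      has_vector_derivative vector [p, q, m * t + z' u]) (at u within I)"
    by (rule has_vector_derivative_vector_3;
        unfold has_real_derivative_iff_has_vector_derivative[symmetric];
        auto intro!: z_u derivative_eq_intros)
  show "((\<lambda>r. vector [a * r + p * u, b * r + q * u, c * r + k / 2 * r\<^sup>2 + m * r * u + z u] :: real^3)
      has_vector_derivative vector [a, b, c + k * t + m * u]) (at t)"
    by (rule has_vector_derivative_vector_3;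
        unfold has_real_derivative_iff_has_vector_derivative[symmetric];
        auto intro!: derivative_eq_intros)
qed

lemma partial_1_X: "u \<in> I \<Longrightarrow> partial_1 I X u t = vector [p, q, m * t + z' u]"
  by (simp add: has_partials_on_imp_partial_1[OF partials_X] nontrivial)

lemma partial_2_X: "u \<in> I \<Longrightarrow> partial_2 UNIV X u t = vector [a, b, c + k * t + m * u]"
  by (simp add: has_partials_on_imp_partial_2[OF partials_X])

lemma partials_partial_1_X:
  "has_partials_on I UNIV (partial_1 I X) (\<lambda>u t. vector [0, 0, z'' u]) (\<lambda>u t. vector [0, 0, m])"
proof (rule has_partials_on_cong)
  show "has_partials_on I UNIV (\<lambda>u t. vector [p, q, m * t + z' u])
      (\<lambda>u t. vector [0, 0, z'' u]) (\<lambda>u t. vector [0, 0, m])"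
    unfolding has_partials_on_def
  proof (intro ballI conjI)
    fix u t :: real assume u: "u \<in> I"
    have z'_u: "(z' has_real_derivative z'' u) (at u within I)"
      using z'[OF u] by (simp add: has_real_derivative_iff_has_vector_derivative)
    show "((\<lambda>r. vector [p, q, m * t + z' r] :: real^3) has_vector_derivative vector [0, 0, z'' u])
        (at u within I)"
      by (rule has_vector_derivative_vector_3;
          unfold has_real_derivative_iff_has_vector_derivative[symmetric];
          auto intro!: z'_u derivative_eq_intros)
    show "((\<lambda>r. vector [p, q, m * r + z' u] :: real^3) has_vector_derivative vector [0, 0, m])
        (at t)"
      by (rule has_vector_derivative_vector_3;
          unfold has_real_derivative_iff_has_vector_derivative[symmetric];
          auto intro!: derivative_eq_intros)
  qed
qed (rule partial_1_X)

lemma partials_partial_2_X: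
  "has_partials_on I UNIV (partial_2 UNIV X) (\<lambda>u t. vector [0, 0, m]) (\<lambda>u t. vector [0, 0, k])"
proof (rule has_partials_on_cong)
  show "has_partials_on I UNIV (\<lambda>u t. vector [a, b, c + k * t + m * u])
      (\<lambda>u t. vector [0, 0, m]) (\<lambda>u t. vector [0, 0, k])"
    unfolding has_partials_on_def
    by (intro ballI conjI; rule has_vector_derivative_vector_3;
        unfold has_real_derivative_iff_has_vector_derivative[symmetric];
        auto intro!: derivative_eq_intros)
qed (rule partial_2_X)

lemma C2_surface_parabolic: "C2_surface_on I UNIV X"
  unfolding C2_surface_on_def
proof (intro conjI)
  note cont = continuous_on_vector_3 continuous_on_add continuous_on_mult continuous_on_const
    continuous_on_fst continuous_on_snd continuous_on_id
    continuous_on_compose2[OF continuous_on_z' continuous_on_fst]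
    continuous_on_compose2[OF z'' continuous_on_fst]
  show "C1_surface_on I UNIV X"
    by (rule C1_surface_onI[OF partials_X])
      (auto simp: case_prod_beta nontrivial intro!: cont)
  show "C1_surface_on I UNIV (partial_1 I X)"
    by (rule C1_surface_onI[OF partials_partial_1_X])
      (auto simp: case_prod_beta nontrivial intro!: cont)
  show "C1_surface_on I UNIV (partial_2 UNIV X)"
    by (rule C1_surface_onI[OF partials_partial_2_X])
      (auto simp: case_prod_beta nontrivial intro!: cont)
qed

lemma admissible_parabolic:
  assumes "p * b - q * a \<noteq> 0"
  shows "admissible_on I UNIV X"
  using assms by (auto simp: admissible_on_def X_minor_def partial_1_X partial_2_X)

text \<open>
  Only the height component \<open>1\<close> of \<open>N_h\<close> meets the vertical second derivatives, and the
  determinant of the first fundamental form is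
  \<open>(p\<^sup>2 - q\<^sup>2) (a\<^sup>2 - b\<^sup>2) - (p a - q b)\<^sup>2 = - (p b - q a)\<^sup>2\<close>.
\<close>

lemma mean_curvature_parabolic:
  assumes "u \<in> I"
  shows "mean_curvature I UNIV X u t =
    - (((p\<^sup>2 - q\<^sup>2) * k - 2 * (p * a - q * b) * m + (a\<^sup>2 - b\<^sup>2) * z'' u)
        / (2 * (p * b - q * a)\<^sup>2))"
proof -
  have second_partials:
    "partial_1 I (partial_1 I X) u t = vector [0, 0, z'' u]"
    "partial_2 UNIV (partial_1 I X) u t = vector [0, 0, m]"
    "partial_2 UNIV (partial_2 UNIV X) u t = vector [0, 0, k]"
    using assms nontrivial
    by (simp_all add: has_partials_on_imp_partial_1[OF partials_partial_1_X]
        has_partials_on_imp_partial_2[OF partials_partial_1_X]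
        has_partials_on_imp_partial_2[OF partials_partial_2_X])
  have det: "(p * p - q * q) * (a * a - b * b) - (p * a - q * b)\<^sup>2 = - ((p * b - q * a)\<^sup>2)"
    by algebra
  have "mean_curvature I UNIV X u t =
      1 / 2 * (((p * p - q * q) * k - 2 * (p * a - q * b) * m + (a * a - b * b) * z'' u) /
        ((p * p - q * q) * (a * a - b * b) - (p * a - q * b)\<^sup>2))"
    using assms
    by (simp add: mean_curvature_def Let_def second_partials partial_1_X partial_2_X
        pz_inner_def inner_1_def N_h_def)
  then show ?thesis
    unfolding det by (simp add: power2_eq_square)
qed

end

end

section \<open>The profile with prescribed mean curvature\<close>

text \<open>
  Two applications of the fundamental theorem: the inner integral is differentiable because \<open>H\<close> is
  continuous, hence itself continuous, and so the outer integral is differentiable as well.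
\<close>

lemma z_profile_twice_differentiable:
  fixes a b c1 c2 B s0 h0 h1 :: real
  assumes I: "is_interval I" "interior I \<noteq> {}" "s0 \<in> I" and H: "continuous_on I H"
  defines "C \<equiv> (a * c1 - b * c2) / (a\<^sup>2 - b\<^sup>2)" and "D \<equiv> 2 * B\<^sup>2 / (a\<^sup>2 - b\<^sup>2)"
  shows "twice_differentiable_profile I (z_profile a b c1 c2 B H s0 h0 h1)
    (\<lambda>s. h1 + C * s - D * (LBINT w=ereal s0..ereal s. H w)) (\<lambda>s. C - D * H s)"
proof
  show "is_interval I" "interior I \<noteq> {}" by fact+
  let ?F = "\<lambda>s. LBINT w=ereal s0..ereal s. H w"
  have F: "(?F has_vector_derivative H s) (at s within I)" if "s \<in> I" for s
    using I H that by (intro interval_integral_has_vector_derivative)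
  then have "continuous_on I ?F"
    by (rule continuous_on_vector_derivative)
  then have G: "((\<lambda>s. LBINT v=ereal s0..ereal s. ?F v) has_vector_derivative ?F s) (at s within I)"
    if "s \<in> I" for s
    using I that by (intro interval_integral_has_vector_derivative)
  fix s assume s: "s \<in> I"
  have "(a * c1 - b * c2) / (2 * (a\<^sup>2 - b\<^sup>2)) = C / 2"
    by (simp add: C_def)
  then have "z_profile a b c1 c2 B H s0 h0 h1 =
      (\<lambda>s. h0 + h1 * s + C / 2 * s\<^sup>2 - D * (LBINT v=ereal s0..ereal s. ?F v))"
    unfolding z_profile_def D_def by (intro ext) (simp only:)
  then show "(z_profile a b c1 c2 B H s0 h0 h1 has_vector_derivative h1 + C * s - D * ?F s)
      (at s within I)"
    using G[OF s] by (auto intro!: derivative_eq_intros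
        simp flip: has_real_derivative_iff_has_vector_derivative)
  show "((\<lambda>s. h1 + C * s - D * ?F s) has_vector_derivative C - D * H s) (at s within I)"
    using F[OF s] by (auto intro!: derivative_eq_intros
        simp flip: has_real_derivative_iff_has_vector_derivative)
next
  show "continuous_on I (\<lambda>s. C - D * H s)"
    by (intro continuous_intros H)
qed

lemma bij_triangular_initial_values:
  fixes A C s :: real
  shows "bij (\<lambda>(h0, h1). (h0 + h1 * s + A, h1 + C))"
  by (rule bij_betw_byWitness[where f' = "\<lambda>(y0, y1). (y0 - (y1 - C) * s - A, y1 - C)"]) auto

text \<open>
  The integral terms vanish at the base point, so the slope there determines \<open>h1\<close>, and then the
  value determines \<open>h0\<close>.
\<close>

lemma bij_z_profile_initial_values:
  fixes p q a b c1 c2 B s0 :: real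
    and I :: "real set" and H :: "real \<Rightarrow> real"
  assumes I: "is_interval I" "interior I \<noteq> {}" "s0 \<in> I" and H: "continuous_on I H"
  defines "\<alpha> \<equiv> \<lambda>h0 h1 s. vector [p * s, q * s, z_profile a b c1 c2 B H s0 h0 h1 s] :: real^3"
  shows "bij (\<lambda>(h0, h1). (\<alpha> h0 h1 s0 $ 3, vector_derivative (\<alpha> h0 h1) (at s0 within I) $ 3))"
proof -
  define C where "C = (a * c1 - b * c2) / (a\<^sup>2 - b\<^sup>2)"
  have "\<alpha> h0 h1 s0 $ 3 = h0 + h1 * s0 + C / 2 * s0\<^sup>2" for h0 h1
    by (simp add: \<alpha>_def z_profile_def C_def)
  moreover have "vector_derivative (\<alpha> h0 h1) (at s0 within I) $ 3 = h1 + C * s0" for h0 h1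
    unfolding \<alpha>_def C_def
    by (subst twice_differentiable_profile.line_profile_derivatives(2)
        [OF z_profile_twice_differentiable[OF I H]]) (use I in simp_all)
  ultimately show ?thesis
    using bij_triangular_initial_values by simp
qed

text \<open>
  The hypothesis relating \<open>k\<close>, \<open>m\<close> and \<open>(p, q)\<close> says that \<open>a c1 - b c2\<close> is exactly the constant
  that cancels the contribution of \<open>h\<^sub>1\<^sub>2\<close> and \<open>h\<^sub>2\<^sub>2\<close> to the mean curvature; \<open>B\<^sup>2\<close> is the
  absolute value of the determinant of the first fundamental form.
\<close>

lemma mean_curvature_z_profile:
  assumes I: "is_interval I" "interior I \<noteq> {}" "s0 \<in> I" "s \<in> I" and H: "continuous_on I H"
    and "a\<^sup>2 \<noteq> b\<^sup>2" "B \<noteq> 0" and B: "(p * b - q * a)\<^sup>2 = B\<^sup>2"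
    and km: "(p\<^sup>2 - q\<^sup>2) * k - 2 * (p * a - q * b) * m = - (a * c1 - b * c2)"
  shows "mean_curvature I UNIV
    (parabolic_surface a b p q c k m (z_profile a b c1 c2 B H s0 h0 h1)) s t = H s"
proof -
  let ?z'' = "(a * c1 - b * c2) / (a\<^sup>2 - b\<^sup>2) - 2 * B\<^sup>2 / (a\<^sup>2 - b\<^sup>2) * H s"
  have "(a\<^sup>2 - b\<^sup>2) * ?z'' = a * c1 - b * c2 - 2 * B\<^sup>2 * H s"
  proof -
    have "d * (n / d - e / d * h) = n - e * h" if "d \<noteq> 0" for d n e h :: real
      using that by (simp add: field_simps)
    then show ?thesis using \<open>a\<^sup>2 \<noteq> b\<^sup>2\<close> by simp
  qed
  then have "(p\<^sup>2 - q\<^sup>2) * k - 2 * (p * a - q * b) * m + (a\<^sup>2 - b\<^sup>2) * ?z'' = - (2 * B\<^sup>2) * H s"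
    using km by linarith
  then show ?thesis
    unfolding twice_differentiable_profile.mean_curvature_parabolic
        [OF z_profile_twice_differentiable[OF I(1-3) H] I(4)] B
    using \<open>B \<noteq> 0\<close> by (simp only:) simp
qed

theorem theorem6p7:
  fixes a b c c1 c2 s0 :: real and I :: "real set" and H :: "real \<Rightarrow> real"
  assumes "a * c1 + b * c2 \<noteq> 0"
    and "a\<^sup>2 \<noteq> b\<^sup>2"
    and "is_interval I" and "interior I \<noteq> {}" and "I \<subseteq> {0<..}" and "s0 \<in> I"
    and "continuous_on I H"
  shows
    "(b \<noteq> 0 \<longrightarrow>
       (\<exists>\<alpha> :: real \<Rightarrow> real \<Rightarrow> real \<Rightarrow> real^3.
          (\<forall>h0 h1.
             spacelike_generating_curve I (\<alpha> h0 h1) \<and>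
             arc_length_param_on I (\<alpha> h0 h1) \<and>
             (\<forall>s\<in>I. \<alpha> h0 h1 s = vector [s, 0, z_profile a b c1 c2 b H s0 h0 h1 s]) \<and>
             C2_surface_on I UNIV (Zh3 a b c c1 c2 (\<alpha> h0 h1)) \<and>
             admissible_on I UNIV (Zh3 a b c c1 c2 (\<alpha> h0 h1)) \<and>
             (\<forall>s\<in>I. \<forall>t. mean_curvature I UNIV (Zh3 a b c c1 c2 (\<alpha> h0 h1)) s t = H s)) \<and>
          bij (\<lambda>(h0, h1). (\<alpha> h0 h1 s0 $ 3,
                            vector_derivative (\<alpha> h0 h1) (at s0 within I) $ 3)))) \<and>
     (a \<noteq> 0 \<longrightarrow>
       (\<exists>\<alpha> :: real \<Rightarrow> real \<Rightarrow> real \<Rightarrow> real^3.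
          (\<forall>h0 h1.
             timelike_generating_curve I (\<alpha> h0 h1) \<and>
             arc_length_param_on I (\<alpha> h0 h1) \<and>
             (\<forall>s\<in>I. \<alpha> h0 h1 s = vector [0, s, z_profile a b c1 c2 a H s0 h0 h1 s]) \<and>
             C2_surface_on I UNIV (Wh3 a b c c1 c2 (\<alpha> h0 h1)) \<and>
             admissible_on I UNIV (Wh3 a b c c1 c2 (\<alpha> h0 h1)) \<and>
             (\<forall>s\<in>I. \<forall>t. mean_curvature I UNIV (Wh3 a b c c1 c2 (\<alpha> h0 h1)) s t = H s)) \<and>
          bij (\<lambda>(h0, h1). (\<alpha> h0 h1 s0 $ 3,
                            vector_derivative (\<alpha> h0 h1) (at s0 within I) $ 3))))"
proof -
  note I = assms(3,4,6) and H = assms(7)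
  let ?z = "\<lambda>B. z_profile a b c1 c2 B H s0"
  let ?k = "a * c1 + b * c2"
  note profile = z_profile_twice_differentiable[OF I H]
  note derivative = twice_differentiable_profile.line_profile_derivatives(2)[OF profile]
    and curve = twice_differentiable_profile.C2_curve_line_profile[OF profile]
    and surface = twice_differentiable_profile.C2_surface_parabolic[OF profile]
    and admissible = twice_differentiable_profile.admissible_parabolic[OF profile]
    and bij = bij_z_profile_initial_values[OF I H]
  show ?thesis
  proof (intro conjI impI)
    assume "b \<noteq> 0"
    \<comment> \<open>The factors \<open>1\<close> and \<open>0\<close> exhibit the curve as one over the direction \<open>(p, q) = (1, 0)\<close>.\<close>
    define \<alpha> where "\<alpha> h0 h1 s = (vector [1 * s, 0 * s, ?z b h0 h1 s] :: real^3)" for h0 h1 s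
    have \<alpha>: "\<alpha> h0 h1 = (\<lambda>s. vector [1 * s, 0 * s, ?z b h0 h1 s])" for h0 h1
      by (simp add: \<alpha>_def fun_eq_iff)
    have Z: "Zh3 a b c c1 c2 (\<alpha> h0 h1) = parabolic_surface a b 1 0 c ?k c1 (?z b h0 h1)" for h0 h1
      by (simp add: fun_eq_iff Zh3_def parabolic_surface_def \<alpha>_def)
    show "\<exists>\<alpha>. (\<forall>h0 h1.
             spacelike_generating_curve I (\<alpha> h0 h1) \<and>
             arc_length_param_on I (\<alpha> h0 h1) \<and>
             (\<forall>s\<in>I. \<alpha> h0 h1 s = vector [s, 0, ?z b h0 h1 s]) \<and>
             C2_surface_on I UNIV (Zh3 a b c c1 c2 (\<alpha> h0 h1)) \<and>
             admissible_on I UNIV (Zh3 a b c c1 c2 (\<alpha> h0 h1)) \<and>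
             (\<forall>s\<in>I. \<forall>t. mean_curvature I UNIV (Zh3 a b c c1 c2 (\<alpha> h0 h1)) s t = H s)) \<and>
          bij (\<lambda>(h0, h1). (\<alpha> h0 h1 s0 $ 3, vector_derivative (\<alpha> h0 h1) (at s0 within I) $ 3))"
    proof (intro exI[of _ \<alpha>] conjI allI ballI)
      fix h0 h1
      show "spacelike_generating_curve I (\<alpha> h0 h1)"
        unfolding spacelike_generating_curve_def \<alpha> using curve
        by (simp only: derivative Let_def cong: ball_cong) (simp add: pz_inner_def)
      show "arc_length_param_on I (\<alpha> h0 h1)"
        unfolding arc_length_param_on_def \<alpha>
        by (simp only: derivative Let_def cong: ball_cong) (simp add: pz_inner_def)
      show "\<alpha> h0 h1 s = vector [s, 0, ?z b h0 h1 s]" for s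
        by (simp add: \<alpha>_def)
      show "C2_surface_on I UNIV (Zh3 a b c c1 c2 (\<alpha> h0 h1))"
        unfolding Z by (rule surface)
      show "admissible_on I UNIV (Zh3 a b c c1 c2 (\<alpha> h0 h1))"
        unfolding Z using \<open>b \<noteq> 0\<close> by (intro admissible) simp
      show "mean_curvature I UNIV (Zh3 a b c c1 c2 (\<alpha> h0 h1)) s t = H s" if "s \<in> I" for s t
        unfolding Z using I that H \<open>a\<^sup>2 \<noteq> b\<^sup>2\<close> \<open>b \<noteq> 0\<close>
        by (intro mean_curvature_z_profile) simp_all
    next
      show "bij (\<lambda>(h0, h1). (\<alpha> h0 h1 s0 $ 3, vector_derivative (\<alpha> h0 h1) (at s0 within I) $ 3))"
        unfolding \<alpha> by (rule bij)
    qed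
  next
    assume "a \<noteq> 0"
    define \<alpha> where "\<alpha> h0 h1 s = (vector [0 * s, 1 * s, ?z a h0 h1 s] :: real^3)" for h0 h1 s
    have \<alpha>: "\<alpha> h0 h1 = (\<lambda>s. vector [0 * s, 1 * s, ?z a h0 h1 s])" for h0 h1
      by (simp add: \<alpha>_def fun_eq_iff)
    have W: "Wh3 a b c c1 c2 (\<alpha> h0 h1) = parabolic_surface a b 0 1 c ?k c2 (?z a h0 h1)" for h0 h1
      by (simp add: fun_eq_iff Wh3_def parabolic_surface_def \<alpha>_def)
    show "\<exists>\<alpha>. (\<forall>h0 h1.
             timelike_generating_curve I (\<alpha> h0 h1) \<and>
             arc_length_param_on I (\<alpha> h0 h1) \<and>
             (\<forall>s\<in>I. \<alpha> h0 h1 s = vector [0, s, ?z a h0 h1 s]) \<and>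
             C2_surface_on I UNIV (Wh3 a b c c1 c2 (\<alpha> h0 h1)) \<and>
             admissible_on I UNIV (Wh3 a b c c1 c2 (\<alpha> h0 h1)) \<and>
             (\<forall>s\<in>I. \<forall>t. mean_curvature I UNIV (Wh3 a b c c1 c2 (\<alpha> h0 h1)) s t = H s)) \<and>
          bij (\<lambda>(h0, h1). (\<alpha> h0 h1 s0 $ 3, vector_derivative (\<alpha> h0 h1) (at s0 within I) $ 3))"
    proof (intro exI[of _ \<alpha>] conjI allI ballI)
      fix h0 h1
      show "timelike_generating_curve I (\<alpha> h0 h1)"
        unfolding timelike_generating_curve_def \<alpha> using curve
        by (simp only: derivative Let_def cong: ball_cong) (simp add: pz_inner_def)
      show "arc_length_param_on I (\<alpha> h0 h1)"
        unfolding arc_length_param_on_def \<alpha>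
        by (simp only: derivative Let_def cong: ball_cong) (simp add: pz_inner_def)
      show "\<alpha> h0 h1 s = vector [0, s, ?z a h0 h1 s]" for s
        by (simp add: \<alpha>_def)
      show "C2_surface_on I UNIV (Wh3 a b c c1 c2 (\<alpha> h0 h1))"
        unfolding W by (rule surface)
      show "admissible_on I UNIV (Wh3 a b c c1 c2 (\<alpha> h0 h1))"
        unfolding W using \<open>a \<noteq> 0\<close> by (intro admissible) simp
      show "mean_curvature I UNIV (Wh3 a b c c1 c2 (\<alpha> h0 h1)) s t = H s" if "s \<in> I" for s t
        unfolding W using I that H \<open>a\<^sup>2 \<noteq> b\<^sup>2\<close> \<open>a \<noteq> 0\<close>
        by (intro mean_curvature_z_profile) simp_all
    next
      show "bij (\<lambda>(h0, h1). (\<alpha> h0 h1 s0 $ 3, vector_derivative (\<alpha> h0 h1) (at s0 within I) $ 3))"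
        unfolding \<alpha> by (rule bij)
    qed
  qed
qed

end
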